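(* Let $f$ be a continuously differentiable probability density with full support $\mathbb{R}$, and let $\varphi_f(x)=-f'(x)/f(x)$, $x\in\mathbb{R}$, be its location score function. Assume that $\varphi_f$ is invertible over $\mathbb{R}$ and crosses the $x$-axis. Then there exists $N\in\mathbb{N}\cup\{\infty\}$, depending only on $f$, such that for every continuously differentiable probability density $g$ with full support $\mathbb{R}$ and for any $n\ge N$, the following equivalence holds: $\hat\theta^{(n)}_f=\hat\theta^{(n)}_g$ for all samples of size $n$ if and only if there exist constants $c,d\in(0,\infty)$ such that $g(x)=c(f(x))^d$ for all $x\in\mathbb{R}$, that is, if and only if $f$ and $g$ belong to the same location-based equivalence class. The smallest such $N$ (the minimal necessary sample size) is $\mathrm{MNSS}=\max\{N_f,3\}$. Here, when $N=\infty$, the equivalence is understood as: $\hat\theta^{(n)}_f=\hat\theta^{(n)}_g$ for all samples of all sample sizes $n\in\mathbb{N}$ if and only if there exist $c,d\in(0,\infty)$ with $g=cf^d$ on $\mathbb{R}$; and $\mathrm{MNSS}=\infty$ means in addition that no finite $N$ works.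
   Context: A density has full support $\mathbb{R}$ if it is strictly positive on $\mathbb{R}$ (densities are with respect to Lebesgue measure). Location MLE: for a density $f$, $n\ge 1$ and a sample $\mathbf{x}^{(n)}=(x_1,\dots,x_n)\in\mathbb{R}^n$, the maximum likelihood estimator $\hat\theta^{(n)}_f(\mathbf{x}^{(n)})$ of the location parameter is a maximizer over $\theta\in\mathbb{R}$ of $\prod_{i=1}^n f(x_i-\theta)$. "$\hat\theta^{(n)}_f=\hat\theta^{(n)}_g$ for all samples of size $n$" means that the $f$-MLE is also an MLE for $g$: for every $\mathbf{x}^{(n)}\in\mathbb{R}^n$, $$\sum_{i=1}^n\log g\bigl(x_i-\hat\theta^{(n)}_f(\mathbf{x}^{(n)})\bigr)\ \ge\ \sum_{i=1}^n\log g(x_i-\theta)\quad\text{for all }\theta\in\mathbb{R}.$$ Location-based equivalence class of $f$: the set of all densities of the form $c f^d$ with $d>0$ and $c$ the normalizing constant. Minimal covering sample size: write the image of $\varphi_f$ as $\{\varphi_f(x):x\in\mathbb{R}\}=(-P^-_f,P^+_f)$ with $0<P^-_f,P^+_f\le\infty$. Then $$N_f=\begin{cases}2 & \text{if } P^-_f=P^+_f \text{ (including both infinite)},\\ \left\lceil \dfrac{\max(P^+_f,P^-_f)}{\min(P^+_f,P^-_f)}+1\right\rceil & \text{if } P^-_f\ne P^+_f \text{ and both are finite},\\ \infty & \text{otherwise.}\end{cases}$$ *)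

theory Defs
  imports "HOL-Probability.Probability"
begin

definition full_support_density :: "(real \<Rightarrow> real) \<Rightarrow> bool" where
  "full_support_density f \<longleftrightarrow>
     (\<forall>x. 0 < f x) \<and> f \<in> borel_measurable borel \<and>
     prob_space (density lborel (\<lambda>x. ennreal (f x)))"

definition location_score :: "(real \<Rightarrow> real) \<Rightarrow> real \<Rightarrow> real" where
  "location_score f x = - deriv f x / f x"

definition crosses_zero :: "(real \<Rightarrow> real) \<Rightarrow> bool" where
  "crosses_zero h \<longleftrightarrow> (\<exists>a b. h a < 0 \<and> 0 < h b)"

text \<open>
  A sample of size \<open>n\<close> is a function \<open>x :: nat \<Rightarrow> real\<close> of which only the values
  \<open>x 1, \<dots>, x n\<close> are used. The estimator is a choice of maximizer; if the score of \<open>f\<close> is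
  injective and crosses zero, the maximizer exists and is unique for every \<open>n \<ge> 1\<close>.
\<close>

definition location_mle :: "(real \<Rightarrow> real) \<Rightarrow> nat \<Rightarrow> (nat \<Rightarrow> real) \<Rightarrow> real" where
  "location_mle f n x = arg_max (\<lambda>\<theta>. \<Prod>i=1..n. f (x i - \<theta>)) (\<lambda>\<theta>. True)"

text \<open>Not symmetric in \<open>f\<close> and \<open>g\<close>: the MLE of \<open>f\<close> is required to be an MLE of \<open>g\<close>.\<close>

definition same_location_mle :: "nat \<Rightarrow> (real \<Rightarrow> real) \<Rightarrow> (real \<Rightarrow> real) \<Rightarrow> bool" where
  "same_location_mle n f g \<longleftrightarrow>
     (\<forall>x :: nat \<Rightarrow> real. \<forall>\<theta>.
        (\<Sum>i=1..n. ln (g (x i - location_mle f n x))) \<ge> (\<Sum>i=1..n. ln (g (x i - \<theta>))))"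

text \<open>Being a density forces \<open>c\<close> to be the normalizing constant of \<open>f\<^sup>d\<close>.\<close>

definition location_class :: "(real \<Rightarrow> real) \<Rightarrow> (real \<Rightarrow> real) set" where
  "location_class f =
     {g. full_support_density g \<and> (\<exists>c d. 0 < d \<and> (\<forall>x. g x = c * f x powr d))}"

text \<open>End points of the image \<open>(- P_minus f, P_plus f)\<close> of the score function.\<close>

definition P_plus :: "(real \<Rightarrow> real) \<Rightarrow> ereal" where
  "P_plus f = (SUP x. ereal (location_score f x))"

definition P_minus :: "(real \<Rightarrow> real) \<Rightarrow> ereal" where
  "P_minus f = - (INF x. ereal (location_score f x))"

lemma P_plus_P_minus_eqI:
  assumes "range (\<lambda>x. ereal (location_score f x)) = {- p <..< q}" "0 < p" "0 < q"
  shows "P_minus f = p" "P_plus f = q"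
proof -
  have "- p < q"
    using assms(2,3) by (cases p; cases q) auto
  then show "P_minus f = p" "P_plus f = q"
    by (simp_all add: P_minus_def P_plus_def assms(1))
qed

definition min_covering_size :: "(real \<Rightarrow> real) \<Rightarrow> enat" where
  "min_covering_size f =
     (if P_minus f = P_plus f then 2
      else if P_minus f \<noteq> \<infinity> \<and> P_plus f \<noteq> \<infinity> then
        enat (nat \<lceil>real_of_ereal (max (P_plus f) (P_minus f)) /
                   real_of_ereal (min (P_plus f) (P_minus f)) + 1\<rceil>)
      else \<infinity>)"

text \<open>
  \<open>N\<close> is a sample size from which on the MLE identifies \<open>f\<close> up to its class, among all
  continuously differentiable densities \<open>g\<close> of full support. For \<open>N = \<infinity>\<close> the MLEs are compared for
  all sample sizes simultaneously.
\<close>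

definition sufficient_sample_size :: "(real \<Rightarrow> real) \<Rightarrow> enat \<Rightarrow> bool" where
  "sufficient_sample_size f N \<longleftrightarrow>
     (\<forall>g. full_support_density g \<and> g C1_differentiable_on UNIV \<longrightarrow>
        (if N = \<infinity> then
           (\<forall>n\<ge>1. same_location_mle n f g) \<longleftrightarrow>
             (\<exists>c d. 0 < c \<and> 0 < d \<and> (\<forall>x. g x = c * f x powr d))
         else
           (\<forall>n\<ge>1. enat n \<ge> N \<longrightarrow>
              (same_location_mle n f g \<longleftrightarrow>
                (\<exists>c d. 0 < c \<and> 0 < d \<and> (\<forall>x. g x = c * f x powr d))))))"

definition MNSS :: "(real \<Rightarrow> real) \<Rightarrow> enat" where
  "MNSS f = (LEAST N. sufficient_sample_size f N)"

end

theory Submission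
  imports Defs
begin

text \<open>
  Let \<open>\<phi>\<close> and \<open>\<psi>\<close> be the scores of \<open>f\<close> and \<open>g\<close>. Since \<open>f\<close> is integrable, \<open>\<phi>\<close> is increasing, so
  \<open>ln f\<close> is strictly concave, the MLE is the zero of \<open>\<Sum>i. \<phi> (x i - \<theta>)\<close>, and agreement of the MLEs at
  sample size \<open>n\<close> forces \<open>h = \<psi> \<circ> \<phi>\<^sup>-\<^sup>1\<close> to map \<open>n\<close>-tuples of scores with zero sum to such tuples.
  For \<open>n \<ge> 3\<close> this gives a Cauchy equation, whence \<open>h\<close> is linear on the symmetric part of the
  range of \<open>\<phi>\<close>; a score \<open>u\<close> outside is compensated by \<open>n - 1\<close> copies of \<open>- u / (n - 1)\<close>, which
  are scores for every \<open>u\<close> iff \<open>n\<close> is at least the minimal covering size.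

  For smaller \<open>n\<close>, the density with score \<open>h \<circ> \<phi>\<close> is a counterexample if \<open>h\<close> is odd, increasing,
  and the identity on \<open>[- T, T]\<close> but not beyond: oddness suffices for \<open>n = 2\<close>, and otherwise \<open>T\<close>
  is chosen so that no score beyond \<open>T\<close> occurs in a zero-sum tuple.
\<close>

section \<open>Scores as logarithmic derivatives\<close>

lemma DERIV_ln_score:
  assumes "\<And>x. 0 < g x" "g C1_differentiable_on UNIV"
  shows "((\<lambda>x. ln (g x)) has_real_derivative - location_score g x) (at x)"
proof -
  have "g differentiable at x"
    using assms(2) by (auto simp: C1_differentiable_on_eq)
  then have "(g has_real_derivative deriv g x) (at x)"
    using DERIV_deriv_iff_real_differentiable by blast
  then have "((\<lambda>x. ln (g x)) has_real_derivative (1 / g x * deriv g x)) (at x)"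
    using assms(1) by (auto intro!: derivative_eq_intros)
  then show ?thesis
    by (simp add: location_score_def)
qed

lemma isCont_location_score:
  assumes "\<And>x. 0 < g x" "g C1_differentiable_on UNIV"
  shows "isCont (location_score g) x"
proof -
  obtain D where D: "\<And>x. (g has_vector_derivative D x) (at x)" "continuous_on UNIV D"
    using assms(2) unfolding C1_differentiable_on_def by auto
  have "deriv g = D"
    using D(1) by (auto simp: fun_eq_iff has_real_derivative_iff_has_vector_derivative intro!: DERIV_imp_deriv)
  then have "isCont (deriv g) x"
    using D(2) by (simp add: continuous_on_eq_continuous_at)
  moreover have "isCont g x"
    using D(1) by (rule has_vector_derivative_continuous)
  moreover have "g x \<noteq> 0"
    using assms(1)[of x] by simp
  ultimately show ?thesis
    unfolding location_score_def by (intro continuous_intros) auto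
qed

text \<open>Writing \<open>g = exp (ln g)\<close> recovers the derivative of \<open>g\<close>
  itself, so this also serves for functions that are known only through their logarithm.\<close>

lemma location_score_eqI:
  assumes "\<And>x. 0 < g x" "\<And>x. ((\<lambda>x. ln (g x)) has_real_derivative - s x) (at x)"
  shows "(g has_real_derivative - s x * g x) (at x)" "location_score g x = s x"
proof -
  have "((\<lambda>x. exp (ln (g x))) has_real_derivative exp (ln (g x)) * - s x) (at x)"
    by (rule DERIV_fun_exp[OF assms(2)])
  then show D: "(g has_real_derivative - s x * g x) (at x)"
    using assms(1) by (simp add: mult.commute)
  show "location_score g x = s x"
    using DERIV_imp_deriv[OF D] assms(1)[of x] by (simp add: location_score_def)
qed

lemma location_score_powr:
  assumes "\<And>x. 0 < g x" "g C1_differentiable_on UNIV" "0 < c" "\<And>x. h x = c * g x powr d"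
  shows "location_score h x = d * location_score g x"
proof (rule location_score_eqI(2))
  show "0 < h x" for x
    using assms(1)[of x] assms(3,4) by simp
  have "(\<lambda>x. ln (h x)) = (\<lambda>x. ln c + d * ln (g x))"
    using assms(1,3,4) by (auto simp: fun_eq_iff ln_mult ln_powr less_imp_neq[symmetric])
  then show "((\<lambda>x. ln (h x)) has_real_derivative - (d * location_score g x)) (at x)" for x
    using DERIV_add[OF DERIV_const DERIV_cmult[OF DERIV_ln_score[OF assms(1,2)]], of "ln c" d x] by simp
qed

text \<open>The difference \<open>ln g - k * ln f\<close> has derivative \<open>0\<close>. The sign
  of \<open>k\<close> is left open here; \<open>powr_exponent_pos\<close> settles it by
  integrability.\<close>

lemma proportional_score_imp_powr:
  assumes f: "\<And>x. 0 < f x" "f C1_differentiable_on UNIV"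
    and g: "\<And>x. 0 < g x" "g C1_differentiable_on UNIV"
    and k: "\<And>x. location_score g x = k * location_score f x"
  obtains c where "0 < c" "\<And>x. g x = c * f x powr k"
proof
  let ?D = "\<lambda>x. ln (g x) - k * ln (f x)"
  have "(?D has_real_derivative 0) (at x)" for x
    using DERIV_diff[OF DERIV_ln_score[OF g] DERIV_cmult[OF DERIV_ln_score[OF f]], of k x]
    by (simp add: k)
  then have D: "?D x = ?D 0" for x
    using DERIV_isconst_all by blast
  show "g x = exp (?D 0) * f x powr k" for x
    unfolding D[of x, symmetric] using f(1)[of x] g(1)[of x] by (simp add: exp_diff powr_def)
qed simp

section \<open>Consequences of integrability\<close>

lemma full_support_densityD:
  assumes "full_support_density g"
  shows "0 < g x" "integrable lborel g"
proof -
  show "0 < g x"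
    using assms by (simp add: full_support_density_def)
  have "(\<integral>\<^sup>+ x. ennreal (g x) \<partial>lborel) = 1"
    using assms prob_space.emeasure_space_1[of "density lborel (\<lambda>x. ennreal (g x))"]
    by (auto simp: full_support_density_def emeasure_density)
  then show "integrable lborel g"
    using assms by (auto simp: full_support_density_def less_imp_le intro!: integrableI_nonneg)
qed

text \<open>A half-line has infinite Lebesgue measure. This is how integrability rules out
  decreasing scores and nonpositive exponents.\<close>

lemma full_support_density_not_bounded_below:
  assumes g: "full_support_density g" and e: "0 < e" "\<And>x. a \<le> x \<Longrightarrow> e \<le> g x"
  shows False
proof -
  have "integrable lborel (\<lambda>x. e * indicator {a..} x :: real)"
  proof (rule Bochner_Integration.integrable_bound)
    show "integrable lborel g"
      using g by (rule full_support_densityD)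
    show "AE x in lborel. norm (e * indicator {a..} x :: real) \<le> norm (g x)"
      using e full_support_densityD(1)[OF g] by (auto simp: indicator_def less_imp_le)
  qed simp
  then have "integrable lborel (indicator {a..} :: real \<Rightarrow> real)"
    using e(1) by simp
  then have "emeasure lborel {a..} < \<infinity>"
    by (simp add: integrable_indicator_iff)
  moreover have "emeasure lborel {a..} = \<infinity>"
  proof (rule ccontr)
    assume "\<not> ?thesis"
    then obtain r where r: "emeasure lborel {a..} = ennreal r" "0 \<le> r"
      by (cases "emeasure lborel {a..}") auto
    have "emeasure lborel {a..a + (r + 1)} \<le> emeasure lborel {a..}"
      by (rule emeasure_mono) auto
    with r show False by (simp add: ennreal_le_iff)
  qed
  ultimately show False by simp
qed

text \<open>A continuous injective score is strictly monotone. If it decreased, it would stay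
  negative to the right of a point \<open>a\<close> with negative score, so \<open>f\<close> would
  be at least \<open>f a\<close> on a whole half-line.\<close>

lemma strict_mono_location_score:
  assumes f: "full_support_density f" "f C1_differentiable_on UNIV"
    and inj: "inj (location_score f)" and cross: "crosses_zero (location_score f)"
  shows "strict_mono (location_score f)"
proof (rule ccontr)
  note pos = full_support_densityD(1)[OF f(1)]
  have "continuous_on UNIV (location_score f)"
    using isCont_location_score[OF pos f(2)] by (simp add: continuous_on_eq_continuous_at)
  moreover assume "\<not> strict_mono (location_score f)"
  ultimately have anti: "location_score f y < location_score f x" if "x < y" for x y
    using injective_eq_monotone_map[of UNIV "location_score f"] inj that
    by (auto simp: monotone_on_def)
  obtain a where a: "location_score f a < 0"
    using cross by (auto simp: crosses_zero_def)
  have "f a \<le> f x" if "a \<le> x" for x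
  proof -
    have "ln (f a) \<le> ln (f x)"
    proof (rule DERIV_nonneg_imp_nondecreasing[OF that])
      fix y assume "a \<le> y"
      then have "location_score f y \<le> 0"
        using anti[of a y] a by (cases "a = y") auto
      then show "\<exists>d. ((\<lambda>x. ln (f x)) has_real_derivative d) (at y) \<and> 0 \<le> d"
        using DERIV_ln_score[OF pos f(2), of y] by force
    qed
    then show ?thesis using pos by simp
  qed
  then show False
    using full_support_density_not_bounded_below[OF f(1) pos] by blast
qed

section \<open>Concave log-likelihoods and their maximizers\<close>

lemma concave_less_tangent:
  fixes F \<phi> :: "real \<Rightarrow> real"
  assumes F: "\<And>x. (F has_real_derivative - \<phi> x) (at x)" and "strict_mono \<phi>" "y \<noteq> x"
  shows "F y < F x - \<phi> x * (y - x)"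
proof (cases "x < y")
  case True
  obtain z where z: "x < z" "F y - F x = (y - x) * - \<phi> z"
    using MVT2[OF True F] by blast
  then have "\<phi> x * (y - x) < \<phi> z * (y - x)"
    using True assms(2) by (simp add: strict_mono_less)
  then show ?thesis using z(2) by (simp add: algebra_simps)
next
  case False
  then have "y < x" using assms(3) by simp
  obtain z where z: "z < x" "F x - F y = (x - y) * - \<phi> z"
    using MVT2[OF \<open>y < x\<close> F] by blast
  then have "\<phi> z * (x - y) < \<phi> x * (x - y)"
    using \<open>y < x\<close> assms(2) by (simp add: strict_mono_less)
  then show ?thesis using z(2) by (simp add: algebra_simps)
qed

text \<open>The tangent bounds at the points \<open>x i - t\<close> are added up. Their linear terms
  sum to \<open>t - \<theta>\<close> times the score sum at \<open>t\<close>, which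
  vanishes.\<close>

lemma log_likelihood_less:
  fixes x :: "nat \<Rightarrow> real"
  assumes g: "\<And>x. 0 < g x" "g C1_differentiable_on UNIV" "strict_mono (location_score g)"
    and n: "1 \<le> n" and t: "(\<Sum>i=1..n. location_score g (x i - t)) = 0" and "\<theta> \<noteq> t"
  shows "(\<Sum>i=1..n. ln (g (x i - \<theta>))) < (\<Sum>i=1..n. ln (g (x i - t)))"
proof -
  have "(\<Sum>i=1..n. ln (g (x i - \<theta>)))
      < (\<Sum>i=1..n. ln (g (x i - t)) - location_score g (x i - t) * (x i - \<theta> - (x i - t)))"
  proof (rule sum_strict_mono)
    show "ln (g (x i - \<theta>)) < ln (g (x i - t)) - location_score g (x i - t) * (x i - \<theta> - (x i - t))" for i
      using \<open>\<theta> \<noteq> t\<close>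
      by (intro concave_less_tangent[where F = "\<lambda>x. ln (g x)"] DERIV_ln_score g) auto
  qed (use n in simp_all)
  also have "\<dots> = (\<Sum>i=1..n. ln (g (x i - t))) - (\<Sum>i=1..n. location_score g (x i - t)) * (t - \<theta>)"
    by (simp add: sum_subtractf sum_distrib_right)
  finally show ?thesis by (simp only: t mult_zero_left diff_zero)
qed

text \<open>\<open>arg_max\<close> only chooses some maximizer; strictness of the likelihood bound
  makes \<open>t\<close> the only candidate.\<close>

lemma location_mle_eqI:
  assumes f: "\<And>x. 0 < f x" "f C1_differentiable_on UNIV" "strict_mono (location_score f)"
    and n: "1 \<le> n" and t: "(\<Sum>i=1..n. location_score f (x i - t)) = 0"
  shows "location_mle f n x = t"
proof -
  have less: "(\<Prod>i=1..n. f (x i - \<theta>)) < (\<Prod>i=1..n. f (x i - t))" if "\<theta> \<noteq> t" for \<theta>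
  proof -
    have ln: "ln (\<Prod>i=1..n. f (x i - s)) = (\<Sum>i=1..n. ln (f (x i - s)))" for s
      using f(1) by (intro ln_prod) (auto simp: less_imp_neq[symmetric])
    have "ln (\<Prod>i=1..n. f (x i - \<theta>)) < ln (\<Prod>i=1..n. f (x i - t))"
      unfolding ln using log_likelihood_less[OF f n t that] .
    then show ?thesis
      by (subst (asm) ln_less_cancel_iff) (auto intro!: prod_pos f)
  qed
  have "is_arg_max (\<lambda>\<theta>. \<Prod>i=1..n. f (x i - \<theta>)) (\<lambda>_. True) s \<longleftrightarrow> s = t" for s
    unfolding is_arg_max_def using less by (metis less_asym less_irrefl)
  then show ?thesis
    by (simp add: location_mle_def arg_max_def)
qed

text \<open>The intermediate value theorem gives a zero of the score sum, and
  \<open>location_mle_eqI\<close> identifies this zero as the estimator.\<close>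

lemma score_sum_location_mle:
  assumes f: "\<And>x. 0 < f x" "f C1_differentiable_on UNIV" "strict_mono (location_score f)"
    and cross: "crosses_zero (location_score f)" and n: "1 \<le> n"
  shows "(\<Sum>i=1..n. location_score f (x i - location_mle f n x)) = 0"
proof -
  let ?S = "\<lambda>\<theta>. \<Sum>i=1..n. location_score f (x i - \<theta>)"
  obtain a b where ab: "location_score f a < 0" "0 < location_score f b"
    using cross by (auto simp: crosses_zero_def)
  \<comment> \<open>At \<open>?u\<close> every \<open>x i - ?u\<close> is at most \<open>a\<close>,
    and at \<open>?l\<close> every \<open>x i - ?l\<close> is at least \<open>b\<close>, so the
    score sum changes sign in between.\<close>
  let ?l = "Min (x ` {1..n}) - b" and ?u = "Max (x ` {1..n}) - a"
  have "?S ?u \<le> 0"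
  proof (rule sum_nonpos)
    fix i assume "i \<in> {1..n}"
    then have "x i \<le> Max (x ` {1..n})" by (intro Max_ge) auto
    then have "x i - ?u \<le> a" by simp
    then show "location_score f (x i - ?u) \<le> 0"
      using ab(1) f(3) by (meson less_imp_le order_trans strict_mono_less_eq)
  qed
  moreover have "0 \<le> ?S ?l"
  proof (rule sum_nonneg)
    fix i assume "i \<in> {1..n}"
    then have "Min (x ` {1..n}) \<le> x i" by (intro Min_le) auto
    then have "b \<le> x i - ?l" by simp
    then show "0 \<le> location_score f (x i - ?l)"
      using ab(2) f(3) by (meson less_imp_le order_trans strict_mono_less_eq)
  qed
  moreover have "?l \<le> ?u"
  proof -
    have "a < b"
      using ab f(3) by (meson less_trans strict_mono_less)
    moreover have "Min (x ` {1..n}) \<le> Max (x ` {1..n})"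
      using n by (intro Min_le_iff[THEN iffD2]) auto
    ultimately show ?thesis by simp
  qed
  moreover have "continuous_on {?l..?u} ?S"
  proof -
    have "continuous_on UNIV (location_score f)"
      using isCont_location_score[OF f(1,2)] by (simp add: continuous_at_imp_continuous_on)
    then have "continuous_on {?l..?u} (\<lambda>\<theta>. location_score f (x i - \<theta>))" for i
      by (rule continuous_on_compose2) (auto intro: continuous_intros)
    then show ?thesis by (rule continuous_on_sum)
  qed
  ultimately obtain t where t: "?S t = 0"
    using IVT2'[of ?S ?u 0 ?l] by auto
  then show ?thesis
    using location_mle_eqI[OF f n t] by simp
qed

text \<open>A sample with zero score sum for \<open>f\<close> has estimator \<open>0\<close>. The
  log-likelihood of \<open>g\<close> is then maximal at \<open>0\<close>, and its derivative there
  is the score sum for \<open>g\<close>.\<close>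

lemma same_location_mle_imp_score:
  assumes f: "\<And>x. 0 < f x" "f C1_differentiable_on UNIV" "strict_mono (location_score f)"
    and g: "\<And>x. 0 < g x" "g C1_differentiable_on UNIV"
    and n: "1 \<le> n" and same: "same_location_mle n f g"
    and y: "(\<Sum>i=1..n. location_score f (y i)) = 0"
  shows "(\<Sum>i=1..n. location_score g (y i)) = 0"
proof -
  let ?L = "\<lambda>\<theta>. \<Sum>i=1..n. ln (g (y i - \<theta>))"
  have "location_mle f n y = 0"
    using f n y by (intro location_mle_eqI) auto
  then have max: "?L \<theta> \<le> ?L 0" for \<theta>
    using same unfolding same_location_mle_def by metis
  have "(?L has_real_derivative (\<Sum>i=1..n. - location_score g (y i - 0) * (0 - 1))) (at 0)"
  proof (rule DERIV_sum)
    show "((\<lambda>\<theta>. ln (g (y i - \<theta>))) has_real_derivative - location_score g (y i - 0) * (0 - 1)) (at 0)" for i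
      by (rule DERIV_chain2[where f = "\<lambda>x. ln (g x)"], rule DERIV_ln_score[OF g])
        (auto intro!: derivative_eq_intros)
  qed
  from DERIV_local_max[OF this, of 1] max show ?thesis by simp
qed

text \<open>The converse transfer: for an increasing score of \<open>g\<close>, a zero of the score
  sum is already a global maximizer.\<close>

lemma same_location_mleI:
  assumes f: "\<And>x. 0 < f x" "f C1_differentiable_on UNIV" "strict_mono (location_score f)"
    and cross: "crosses_zero (location_score f)"
    and g: "\<And>x. 0 < g x" "g C1_differentiable_on UNIV" "strict_mono (location_score g)"
    and n: "1 \<le> n"
    and score: "\<And>y. (\<Sum>i=1..n. location_score f (y i)) = 0 \<Longrightarrow> (\<Sum>i=1..n. location_score g (y i)) = 0"
  shows "same_location_mle n f g"
  unfolding same_location_mle_def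
proof (intro allI)
  fix x \<theta>
  have "(\<Sum>i=1..n. location_score g (x i - location_mle f n x)) = 0"
    using score[OF score_sum_location_mle[OF f cross n]] .
  from log_likelihood_less[OF g n this, of \<theta>]
  show "(\<Sum>i=1..n. ln (g (x i - \<theta>))) \<le> (\<Sum>i=1..n. ln (g (x i - location_mle f n x)))"
    by (cases "\<theta> = location_mle f n x") auto
qed

section \<open>Densities with a prescribed score\<close>

text \<open>Tangents at a point with positive and at one with negative score bound
  \<open>exp (F x)\<close> by exponentials that decay to the right and to the left.\<close>

lemma integrable_exp_concave:
  fixes F \<phi> :: "real \<Rightarrow> real"
  assumes F: "\<And>x. (F has_real_derivative - \<phi> x) (at x)" and mono: "strict_mono \<phi>"
    and cross: "crosses_zero \<phi>"
  shows "integrable lborel (\<lambda>x. exp (F x))"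
proof -
  obtain a b where ab: "\<phi> a < 0" "0 < \<phi> b"
    using cross by (auto simp: crosses_zero_def)
  have tangent: "exp (F x) \<le> exp (F z + \<phi> z * z) * exp (- \<phi> z * x)" for x z
  proof -
    have "F x \<le> F z - \<phi> z * (x - z)"
      using concave_less_tangent[OF F mono, of x z] by (cases "x = z") auto
    then have "exp (F x) \<le> exp (F z + \<phi> z * z + - \<phi> z * x)"
      by (simp add: algebra_simps)
    then show ?thesis by (simp only: exp_add)
  qed
  \<comment> \<open>The two tangent bounds, each cut off to its own half-line and written as a
    multiple of an exponential density, so that integrability follows from total mass
    \<open>1\<close>. The argument \<open>0 + (-1) * x\<close> has the shape of
    \<open>lborel_integrable_real_affine\<close>.\<close>
  define G where "G x =
      exp (F b + \<phi> b * b) / \<phi> b * exponential_density (\<phi> b) x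
      + exp (F a + \<phi> a * a) / - \<phi> a * exponential_density (- \<phi> a) (0 + (-1) * x)" for x
  have exp_density: "integrable lborel (exponential_density l)" if "0 < l" for l
  proof (rule integrableI_nonneg)
    show "(\<integral>\<^sup>+ x. ennreal (exponential_density l x) \<partial>lborel) < \<infinity>"
      using prob_space.emeasure_space_1[OF prob_space_exponential_density[OF that]]
      by (simp add: emeasure_density)
  qed (use that in \<open>auto simp: exponential_density_def\<close>)
  have "integrable lborel (\<lambda>x. exponential_density (- \<phi> a) (0 + (-1) * x))"
    using ab by (intro lborel_integrable_real_affine exp_density) auto
  then have G: "integrable lborel G"
    unfolding G_def using ab
    by (intro Bochner_Integration.integrable_add integrable_mult_right exp_density) auto
  show ?thesis
  proof (rule Bochner_Integration.integrable_bound[OF G])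
    have "continuous_on UNIV F"
      using F DERIV_continuous continuous_at_imp_continuous_on by blast
    then show "(\<lambda>x. exp (F x)) \<in> borel_measurable lborel"
      by (auto intro: borel_measurable_continuous_onI continuous_intros)
    have cancel: "C / l * exponential_density l y = C * exp (- l * y)" if "0 < l" "0 \<le> y" for C l y
      using that by (simp add: exponential_density_def mult.commute[of y])
    have "exp (F x) \<le> G x" for x
    proof (cases "0 \<le> x")
      case True
      have "exp (F x) \<le> exp (F b + \<phi> b * b) / \<phi> b * exponential_density (\<phi> b) x"
        using tangent[of x b] cancel[of "\<phi> b" x] ab True by simp
      moreover have "0 \<le> exp (F a + \<phi> a * a) / - \<phi> a * exponential_density (- \<phi> a) (0 + (-1) * x)"
        using ab by (auto simp: exponential_density_def intro!: mult_nonneg_nonneg)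
      ultimately show ?thesis unfolding G_def by linarith
    next
      case False
      have "exp (F x) \<le> exp (F a + \<phi> a * a) / - \<phi> a * exponential_density (- \<phi> a) (0 + (-1) * x)"
        using tangent[of x a] cancel[of "- \<phi> a" "- x"] ab False by simp
      moreover have "exponential_density (\<phi> b) x = 0"
        using False by (simp add: exponential_density_def)
      ultimately show ?thesis by (simp only: G_def mult_zero_right add_0)
    qed
    then show "AE x in lborel. norm (exp (F x)) \<le> norm (G x)"
      by (intro AE_I2) (auto intro: order_trans[OF _ abs_ge_self])
  qed
qed

text \<open>Integrate \<open>- \<phi>\<close> to a log-density, exponentiate and normalize; the
  normalizing constant does not change the score.\<close>

lemma exists_density_with_score:
  assumes cont: "\<And>x. isCont \<phi> x" and mono: "strict_mono \<phi>" and cross: "crosses_zero \<phi>"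
  obtains g where "full_support_density g" "g C1_differentiable_on UNIV" "location_score g = \<phi>"
proof -
  obtain F where F: "\<And>x. (F has_vector_derivative - \<phi> x) (at x)"
    using einterval_antiderivative[of "-\<infinity>" "\<infinity>" "\<lambda>x. - \<phi> x"] cont by auto
  then have F: "(F has_real_derivative - \<phi> x) (at x)" for x
    by (simp add: has_real_derivative_iff_has_vector_derivative)
  note int = integrable_exp_concave[OF F mono cross]
  define Z where "Z = (\<integral>x. exp (F x) \<partial>lborel)"
  define g where "g x = exp (F x) / Z" for x
  have Z: "0 < Z"
  proof -
    \<comment> \<open>A positive function with integral \<open>0\<close> would make the whole line a
      null set.\<close>
    have "Z \<noteq> 0"
    proof
      assume "Z = 0"
      then have "AE x in lborel. exp (F x) = 0"
        using integral_nonneg_eq_0_iff_AE[OF int] by (simp add: Z_def)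
      then have "{x::real. exp (F x) \<noteq> 0} \<in> null_sets lborel"
        by (subst (asm) AE_iff_null) (use int in \<open>auto dest: borel_measurable_integrable\<close>)
      then show False
        by (simp add: null_sets_def)
    qed
    moreover have "0 \<le> Z"
      by (simp add: Z_def)
    ultimately show ?thesis by simp
  qed
  then have pos: "0 < g x" for x
    by (simp add: g_def)
  have ln_g: "((\<lambda>x. ln (g x)) has_real_derivative - \<phi> x) (at x)" for x
  proof -
    have "(\<lambda>x. ln (g x)) = (\<lambda>x. F x - ln Z)"
      using Z by (simp add: g_def fun_eq_iff ln_div)
    then show ?thesis
      using DERIV_diff[OF F DERIV_const] by simp
  qed
  note D = location_score_eqI[OF pos ln_g]
  have cont_g: "continuous_on UNIV g"
    using D(1) DERIV_continuous continuous_at_imp_continuous_on by blast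
  show thesis
  proof
    show "location_score g = \<phi>"
      using D(2) by blast
    show "g C1_differentiable_on UNIV"
      unfolding C1_differentiable_on_def
    proof (intro exI conjI ballI)
      show "(g has_vector_derivative - \<phi> x * g x) (at x)" for x
        using D(1) by (simp add: has_real_derivative_iff_has_vector_derivative)
      have "continuous_on UNIV \<phi>"
        using cont by (simp add: continuous_at_imp_continuous_on)
      then show "continuous_on UNIV (\<lambda>x. - \<phi> x * g x)"
        using cont_g by (intro continuous_intros)
    qed
    have meas: "g \<in> borel_measurable borel"
      using cont_g by (rule borel_measurable_continuous_onI)
    have "integrable lborel g" "integral\<^sup>L lborel g = 1"
      using int Z by (simp_all add: g_def[abs_def] Z_def)
    then have "(\<integral>\<^sup>+ x. ennreal (g x) \<partial>lborel) = 1"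
      using pos by (subst nn_integral_eq_integral) (auto simp: less_imp_le)
    then have "prob_space (density lborel (\<lambda>x. ennreal (g x)))"
      using meas by (intro prob_spaceI) (simp add: emeasure_density)
    then show "full_support_density g"
      using pos meas by (simp add: full_support_density_def)
  qed
qed

section \<open>Cauchy's equation on an interval\<close>

text \<open>
  For symmetric \<open>v\<close> the defect \<open>D t = h (t * v) - t * h v\<close> is additive on \<open>[0, 1]\<close> and vanishes
  at \<open>1\<close>. Where \<open>\<bar>D\<bar>\<close> is maximal, doubling \<open>t\<close> or \<open>1 - t\<close> would double the maximum.
\<close>

lemma zero_sum_preserving_imp_linear:
  fixes h :: "real \<Rightarrow> real"
  assumes R: "is_interval R" and cont: "\<And>u. u \<in> R \<Longrightarrow> isCont h u"
    and zero_sum: "\<And>a b. a \<in> R \<Longrightarrow> b \<in> R \<Longrightarrow> - (a + b) \<in> R \<Longrightarrow> h a + h b + h (- (a + b)) = 0"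
  obtains k where "\<And>u. u \<in> R \<Longrightarrow> - u \<in> R \<Longrightarrow> h u = k * u"
proof -
  have mem: "t * v \<in> R" if "v \<in> R" "- v \<in> R" "\<bar>t\<bar> \<le> 1" for t v
  proof -
    have "\<bar>t * v\<bar> \<le> \<bar>v\<bar>"
      using that(3) by (simp add: abs_mult mult_left_le_one_le)
    moreover have "- \<bar>v\<bar> \<in> R" "\<bar>v\<bar> \<in> R"
      using that(1,2) by (auto simp: abs_if)
    ultimately show ?thesis
      by - (rule mem_is_interval_1_I[OF R, of "- \<bar>v\<bar>" "\<bar>v\<bar>"]; simp add: abs_le_iff)
  qed
  \<comment> \<open>Taking \<open>a = b = 0\<close> gives \<open>3 * h 0 = 0\<close>; then
    \<open>b = 0\<close> gives oddness.\<close>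
  have odd: "h (- u) = - h u" if "u \<in> R" "- u \<in> R" for u
  proof -
    have "0 \<in> R"
      using mem[OF that, of 0] by simp
    then show ?thesis
      using zero_sum[of 0 0] zero_sum[of u 0] that by simp
  qed
  have scale: "h (t * v) = t * h v" if v: "v \<in> R" "- v \<in> R" and t: "0 \<le> t" "t \<le> 1" for t v
  proof -
    define D where "D t = h (t * v) - t * h v" for t
    have add: "D (s + t) = D s + D t" if "0 \<le> s" "0 \<le> t" "s + t \<le> 1" for s t
    proof -
      have "s * v \<in> R" "t * v \<in> R" "(s + t) * v \<in> R" "- (s + t) * v \<in> R"
        using that by (intro mem v; simp)+
      then show ?thesis
        using zero_sum[of "s * v" "t * v"] odd[of "(s + t) * v"]
        by (simp add: D_def algebra_simps)
    qed
    have "isCont (\<lambda>t. h (t * v)) t" if "t \<in> {0..1}" for t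
    proof (rule isCont_o2[where g = h])
      show "isCont h (t * v)"
        using that by (intro cont mem[OF v]) auto
    qed (intro continuous_intros)
    then have "continuous_on {0..1} (\<lambda>t. h (t * v))"
      by (blast intro: continuous_at_imp_continuous_on)
    then have "continuous_on {0..1} (\<lambda>t. \<bar>D t\<bar>)"
      unfolding D_def by (intro continuous_intros)
    then obtain t0 where t0: "t0 \<in> {0..1}" "\<And>t. t \<in> {0..1} \<Longrightarrow> \<bar>D t\<bar> \<le> \<bar>D t0\<bar>"
      using continuous_attains_sup[of "{0..1::real}" "\<lambda>t. \<bar>D t\<bar>"] by auto
    have "D t0 = 0"
    proof (cases "t0 \<le> 1 / 2")
      case True
      then have "D (t0 + t0) = D t0 + D t0"
        using t0(1) by (intro add) auto
      then show ?thesis using t0(2)[of "t0 + t0"] t0(1) True by simp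
    next
      case False
      have "D 1 = 0"
        by (simp add: D_def)
      then have "D (1 - t0) = - D t0"
        using add[of t0 "1 - t0"] t0(1) by simp
      moreover have "D ((1 - t0) + (1 - t0)) = D (1 - t0) + D (1 - t0)"
        using t0(1) False by (intro add) auto
      ultimately show ?thesis using t0(2)[of "(1 - t0) + (1 - t0)"] t0(1) False by simp
    qed
    then have "D t = 0"
      using t0(2)[of t] t by simp
    then show ?thesis by (simp add: D_def)
  qed
  have scale': "h (t * v) = t * h v" if v: "v \<in> R" "- v \<in> R" and t: "\<bar>t\<bar> \<le> 1" for t v
    using scale[OF v, of t] scale[OF v, of "- t"] odd[of "t * v"] mem[OF v t] mem[OF v, of "- t"] t
    by (cases "0 \<le> t") auto
  show thesis
  proof (cases "\<exists>v. v \<in> R \<and> - v \<in> R \<and> v \<noteq> 0")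
    case True
    then obtain v where v: "v \<in> R" "- v \<in> R" "v \<noteq> 0" by blast
    \<comment> \<open>Of \<open>u\<close> and \<open>v\<close>, the one smaller in absolute value is
      a multiple of the other by a factor in \<open>[- 1, 1]\<close>, so one fixed \<open>v\<close>
      determines the slope.\<close>
    have "h u = h v / v * u" if u: "u \<in> R" "- u \<in> R" for u
    proof (cases "\<bar>u\<bar> \<le> \<bar>v\<bar>")
      case True
      then show ?thesis
        using scale'[OF v(1,2), of "u / v"] v(3) by simp
    next
      case False
      then have "u \<noteq> 0" by auto
      then show ?thesis
        using scale'[OF u, of "v / u"] v(3) False by (simp add: field_simps)
    qed
    then show thesis by (rule that)
  next
    \<comment> \<open>Only \<open>0\<close> can lie in \<open>R\<close> together with its negative,
      and \<open>h 0 = 0\<close> by oddness, so any slope works.\<close>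
    case False
    have "h u = 0 * u" if "u \<in> R" "- u \<in> R" for u
    proof -
      have "u = 0"
        using False that by blast
      then show ?thesis
        using odd[of 0] that by simp
    qed
    then show thesis by (rule that)
  qed
qed

section \<open>Intervals under scaled reflection\<close>

text \<open>For finite end points, invariance under \<open>u \<mapsto> - u / k\<close> means
  \<open>q \<le> k * p\<close> and \<open>p \<le> k * q\<close>; as \<open>1 \<le> k\<close>, only
  the bound on the larger end point matters. If exactly one end point is infinite, points far out on
  that side are sent outside the interval.\<close>

lemma interval_scaled_reflection_iff:
  fixes p q :: ereal and k :: real
  assumes "0 < p" "0 < q" "1 \<le> k"
  shows "(\<forall>u. - p < ereal u \<and> ereal u < q \<longrightarrow> - p < ereal (- u / k) \<and> ereal (- u / k) < q) \<longleftrightarrow>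
    p = q \<or> p \<noteq> \<infinity> \<and> q \<noteq> \<infinity> \<and> real_of_ereal (max q p) / real_of_ereal (min q p) \<le> k"
    (is "?L \<longleftrightarrow> ?R")
proof (cases p; cases q)
  fix r s assume pq: "p = ereal r" "q = ereal s"
  then have rs: "0 < r" "0 < s"
    using assms by auto
  have L: "?L \<longleftrightarrow> (\<forall>u. - r < u \<and> u < s \<longrightarrow> - r < - u / k \<and> - u / k < s)"
    by (simp add: pq)
  have "?L \<longleftrightarrow> s \<le> k * r \<and> r \<le> k * s"
    unfolding L
  proof (intro iffI conjI allI impI)
    assume *: "\<forall>u. - r < u \<and> u < s \<longrightarrow> - r < - u / k \<and> - u / k < s"
    \<comment> \<open>Otherwise \<open>u = k * r\<close> lies in the interval, but its image is the
      excluded end point \<open>- r\<close>. The other inequality uses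
      \<open>u = - (k * s)\<close>.\<close>
    show "s \<le> k * r"
    proof (rule ccontr)
      assume "\<not> ?thesis"
      moreover have "- r < k * r"
        using rs assms(3) by (smt (verit) mult_nonneg_nonneg)
      ultimately have "- r < - (k * r) / k" using * by (metis not_le)
      then show False using assms(3) by simp
    qed
    show "r \<le> k * s"
    proof (rule ccontr)
      assume "\<not> ?thesis"
      moreover have "- (k * s) < s"
        using rs assms(3) by (smt (verit) mult_nonneg_nonneg)
      ultimately have "- (- (k * s)) / k < s" using * by (metis neg_less_iff_less not_le)
      then show False using assms(3) by simp
    qed
  next
    fix u assume "s \<le> k * r \<and> r \<le> k * s" "- r < u \<and> u < s"
    then have "u < k * r" "- u < k * s" by auto
    then show "- r < - u / k" "- u / k < s"
      using assms(3) by (simp_all add: field_simps)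
  qed
  also have "\<dots> \<longleftrightarrow> ?R"
  proof -
    have "x \<le> k * x" if "0 < x" for x
      using that assms(3) by simp
    from this[of r] this[of s] have "r < s \<Longrightarrow> r \<le> k * s" "s < r \<Longrightarrow> s \<le> k * r"
      using rs by linarith+
    then show ?thesis
      using rs assms(3)
      by (cases r s rule: linorder_cases) (auto simp: pq max_def min_def divide_le_eq)
  qed
  finally show ?thesis .
next
  fix r assume pq: "p = ereal r" "q = \<infinity>"
  then have "- p < ereal (k * r)" "\<not> - p < ereal (- (k * r) / k)"
    using assms by (auto, smt (verit) mult_nonneg_nonneg)
  then have "\<not> ?L"
    using pq(2) by (auto intro!: exI[of _ "k * r"])
  then show ?thesis
    using pq by simp
next
  fix s assume pq: "p = \<infinity>" "q = ereal s"
  then have "ereal (- (k * s)) < q" "\<not> ereal (- (- (k * s)) / k) < q"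
    using assms by (auto, smt (verit) mult_nonneg_nonneg)
  then have "\<not> ?L"
    using pq(1) by (auto intro!: exI[of _ "- (k * s)"])
  then show ?thesis
    using pq by simp
qed (use assms in auto)

section \<open>A nonlinear odd transformation of scores\<close>

text \<open>For \<open>0 < T\<close> this is the identity on \<open>[- T, T]\<close> and
  \<open>u * \<bar>u\<bar> / T\<close> beyond. The single formula with \<open>max\<close> makes
  oddness and continuity immediate.\<close>

definition stretch :: "real \<Rightarrow> real \<Rightarrow> real" where
  "stretch T u = u * max 1 (\<bar>u\<bar> / T)"

lemma stretch_minus [simp]: "stretch T (- u) = - stretch T u"
  by (simp add: stretch_def)

lemma stretch_zero [simp]: "stretch T 0 = 0"
  by (simp add: stretch_def)

lemma stretch_eq_self: "0 < T \<Longrightarrow> \<bar>u\<bar> \<le> T \<Longrightarrow> stretch T u = u"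
  by (simp add: stretch_def max_def)

lemma isCont_stretch: "0 < T \<Longrightarrow> isCont (stretch T) u"
  unfolding stretch_def by (intro continuous_intros) auto

lemma strict_mono_stretch:
  assumes "0 < T"
  shows "strict_mono (stretch T)"
proof (rule strict_monoI)
  have nonneg: "stretch T u < stretch T v" if "0 \<le> u" "u < v" for u v
  proof -
    have "max 1 (\<bar>u\<bar> / T) \<le> max 1 (\<bar>v\<bar> / T)"
      using that assms by (intro max.mono divide_right_mono) auto
    then have "u * max 1 (\<bar>u\<bar> / T) \<le> u * max 1 (\<bar>v\<bar> / T)"
      using that by (intro mult_left_mono) auto
    also have "\<dots> < v * max 1 (\<bar>v\<bar> / T)"
      using that by (intro mult_strict_right_mono) auto
    finally show ?thesis by (simp add: stretch_def)
  qed
  fix u v :: real assume "u < v"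
  consider "0 \<le> u" | "v \<le> 0" | "u < 0" "0 < v" by linarith
  then show "stretch T u < stretch T v"
  proof cases
    case 2
    then show ?thesis using nonneg[of "- v" "- u"] \<open>u < v\<close> by simp
  next
    case 3
    then show ?thesis using nonneg[of 0 v] nonneg[of 0 "- u"] by simp
  qed (use nonneg \<open>u < v\<close> in auto)
qed

section \<open>Elementary properties of an increasing score\<close>

text \<open>Injectivity of the score is already replaced by monotonicity, which
  \<open>strict_mono_location_score\<close> supplies.\<close>

locale increasing_score =
  fixes f :: "real \<Rightarrow> real"
  assumes density: "full_support_density f"
    and C1: "f C1_differentiable_on UNIV"
    and mono: "strict_mono (location_score f)"
    and cross: "crosses_zero (location_score f)"
begin

abbreviation "\<phi> \<equiv> location_score f"

lemmas pos = full_support_densityD(1)[OF density]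

lemma isCont_score: "isCont \<phi> x"
  by (rule isCont_location_score[OF pos C1])

lemma is_interval_range_score: "is_interval (range \<phi>)"
proof -
  have "connected (range \<phi>)"
    by (intro connected_continuous_image continuous_at_imp_continuous_on ballI isCont_score) auto
  then show ?thesis by (simp add: is_interval_connected_1)
qed

lemma zero_in_range_score: "0 \<in> range \<phi>"
proof -
  obtain a b where "\<phi> a < 0" "0 < \<phi> b"
    using cross by (auto simp: crosses_zero_def)
  then show ?thesis
    by - (rule mem_is_interval_1_I[OF is_interval_range_score, of "\<phi> a" "\<phi> b"]; auto)
qed

lemma score_zero: obtains z where "\<phi> z = 0"
  by (rule rangeE[OF zero_in_range_score]) (rule that, simp)

lemma score_scaled:
  assumes "0 \<le> t" "t \<le> 1"
  obtains z where "\<phi> z = t * \<phi> x"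
proof -
  have "t * \<phi> x \<in> range \<phi>"
  proof (cases "0 \<le> \<phi> x")
    case True
    then show ?thesis
      using assms by - (rule mem_is_interval_1_I[OF is_interval_range_score zero_in_range_score rangeI[of _ x]]; simp add: mult_left_le_one_le)
  next
    case False
    then show ?thesis
      using assms mult_left_le_one_le[of "- \<phi> x" t]
      by - (rule mem_is_interval_1_I[OF is_interval_range_score rangeI[of _ x] zero_in_range_score]; auto simp: mult_nonneg_nonpos)
  qed
  then show thesis
    by (rule rangeE) (rule that, simp)
qed

section \<open>From equal estimators to proportional scores\<close>

text \<open>The size \<open>m\<close> serves only to obtain \<open>k\<close>, by linearity on the
  symmetric part of the range. Then \<open>n\<close> is free, so that a score outside the symmetric
  part may be balanced at a sample size of its own.\<close>

lemma same_location_mle_imp_proportional: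
  assumes g: "\<And>x. 0 < g x" "g C1_differentiable_on UNIV"
    and m: "3 \<le> m" "same_location_mle m f g"
  obtains k where "\<And>n x z. 2 \<le> n \<Longrightarrow> same_location_mle n f g \<Longrightarrow> \<phi> z = - \<phi> x / (real n - 1) \<Longrightarrow>
    location_score g x = k * \<phi> x"
proof -
  define h where "h u = location_score g (inv \<phi> u)" for u
  have inv: "inv \<phi> (\<phi> x) = x" for x
    using mono by (simp add: strict_mono_imp_inj_on)
  then have h: "h (\<phi> x) = location_score g x" for x
    by (simp add: h_def)
  note transfer = same_location_mle_imp_score[OF pos C1 mono g]
  obtain z0 where z0: "\<phi> z0 = 0" by (rule score_zero)
  \<comment> \<open>The constant sample \<open>z0\<close> has zero score sum for \<open>f\<close>.
    The value \<open>0\<close> found here allows \<open>z0\<close> to pad samples for both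
    scores.\<close>
  have gz0: "location_score g z0 = 0"
    using transfer[OF _ m(2), of "\<lambda>_. z0"] m(1) z0 by simp
  have "isCont h u" if u: "u \<in> range \<phi>" for u
  proof -
    obtain x where x: "u = \<phi> x" using u by auto
    have "isCont (inv \<phi>) (\<phi> x)"
      by (rule isCont_inverse_function2[of "x - 1" x "x + 1"]) (auto simp: inv isCont_score)
    then show ?thesis
      unfolding h_def x by (rule isCont_o2) (rule isCont_location_score[OF g])
  qed
  moreover have "h a + h b + h (- (a + b)) = 0"
    if "a \<in> range \<phi>" "b \<in> range \<phi>" "- (a + b) \<in> range \<phi>" for a b
  proof -
    obtain p q r where pqr: "a = \<phi> p" "b = \<phi> q" "- (a + b) = \<phi> r"
      using \<open>a \<in> range \<phi>\<close> \<open>b \<in> range \<phi>\<close> \<open>- (a + b) \<in> range \<phi>\<close> by (elim rangeE) simp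
    \<comment> \<open>Three scores with zero sum, padded by \<open>z0\<close> to size
      \<open>m\<close>.\<close>
    define y :: "nat \<Rightarrow> real" where
      "y i = (if i = 1 then p else if i = 2 then q else if i = 3 then r else z0)" for i
    have sum: "(\<Sum>i=1..m. w (y i)) = w p + w q + w r" if "w z0 = 0" for w :: "real \<Rightarrow> real"
    proof -
      have "(\<Sum>i=1..m. w (y i)) = (\<Sum>i\<in>{1,2,3}. w (y i))"
        using m(1) that by (intro sum.mono_neutral_right) (auto simp: y_def)
      then show ?thesis by (simp add: y_def)
    qed
    have "(\<Sum>i=1..m. location_score g (y i)) = 0"
      using m pqr by (intro transfer) (auto simp only: sum[of \<phi>, OF z0])
    then show ?thesis
      unfolding sum[of "location_score g", OF gz0] pqr(3) unfolding pqr(1,2) h .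
  qed
  ultimately obtain k where k: "\<And>u. u \<in> range \<phi> \<Longrightarrow> - u \<in> range \<phi> \<Longrightarrow> h u = k * u"
    using zero_sum_preserving_imp_linear[OF is_interval_range_score] by blast
  have "location_score g x = k * \<phi> x"
    if n: "2 \<le> n" "same_location_mle n f g" and z: "\<phi> z = - \<phi> x / (real n - 1)" for n x z
  proof -
    define y :: "nat \<Rightarrow> real" where "y i = (if i = 1 then x else z)" for i
    have sum: "(\<Sum>i=1..n. w (y i)) = w x + (real n - 1) * w z" for w :: "real \<Rightarrow> real"
    proof -
      have "(\<Sum>i=1..n. w (y i)) = w (y 1) + (\<Sum>i=Suc 1..n. w (y i))"
        using n(1) by (intro sum.atLeast_Suc_atMost) auto
      also have "(\<Sum>i=Suc 1..n. w (y i)) = (\<Sum>i=Suc 1..n. w z)"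
        by (intro sum.cong) (auto simp: y_def)
      finally show ?thesis using n(1) by (simp add: y_def of_nat_diff)
    qed
    have "location_score g x + (real n - 1) * location_score g z = 0"
      unfolding sum[symmetric] using n by (intro transfer) (auto simp only: sum, simp add: z)
    moreover have "(real n - 1) * location_score g z = - (k * \<phi> x)"
    proof -
      \<comment> \<open>Scaling \<open>\<phi> x\<close> towards \<open>0\<close> shows that
        \<open>- \<phi> z\<close> is a score too, so \<open>\<phi> z\<close> lies in the symmetric
        part, where \<open>h\<close> is linear.\<close>
      obtain z' where "\<phi> z' = 1 / (real n - 1) * \<phi> x"
        using score_scaled[of "1 / (real n - 1)" x] n(1) by auto
      then have "- \<phi> z = \<phi> z'" by (simp add: z)
      then have "- \<phi> z \<in> range \<phi>" by simp
      then have "location_score g z = k * \<phi> z"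
        using k[OF rangeI] by (simp only: h)
      then have "location_score g z = k * (- \<phi> x / (real n - 1))"
        by (simp only: z)
      then show ?thesis using n(1) by simp
    qed
    ultimately show ?thesis by linarith
  qed
  then show thesis by (rule that)
qed

section \<open>Range of the score and covering size\<close>

text \<open>The bounds are strict because \<open>x - 1\<close> and \<open>x + 1\<close> have a
  smaller and a larger score than \<open>x\<close>. Conversely, a number between two scores is a
  score.\<close>

lemma range_score: "u \<in> range \<phi> \<longleftrightarrow> - P_minus f < ereal u \<and> ereal u < P_plus f"
proof
  assume "u \<in> range \<phi>"
  then obtain x where x: "u = \<phi> x" by auto
  have "ereal u < ereal (\<phi> (x + 1))" "ereal (\<phi> (x - 1)) < ereal u"
    using mono by (simp_all add: x strict_mono_less)
  moreover have "ereal (\<phi> (x + 1)) \<le> P_plus f" "- P_minus f \<le> ereal (\<phi> (x - 1))"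
    unfolding P_plus_def P_minus_def by (auto intro: SUP_upper INF_lower)
  ultimately show "- P_minus f < ereal u \<and> ereal u < P_plus f"
    by (meson less_le_trans le_less_trans)
next
  assume "- P_minus f < ereal u \<and> ereal u < P_plus f"
  then obtain a b where "\<phi> a < u" "u < \<phi> b"
    unfolding P_plus_def P_minus_def by (auto simp: less_SUP_iff INF_less_iff)
  then show "u \<in> range \<phi>"
    by - (rule mem_is_interval_1_I[OF is_interval_range_score, of "\<phi> a" "\<phi> b"]; auto)
qed

lemma P_pos: "0 < P_minus f" "0 < P_plus f"
proof -
  show "0 < P_minus f" "0 < P_plus f"
    using zero_in_range_score range_score[of 0] by (simp_all add: zero_ereal_def[symmetric] ereal_uminus_less_reorder)
qed

text \<open>The covering property: each score can be balanced by \<open>n - 1\<close> equal scores.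
  By reflection, this bounds the ratio of the end points by \<open>n - 1\<close>, whence the
  \<open>+ 1\<close> under the ceiling.\<close>

lemma min_covering_size_le_iff:
  assumes "2 \<le> n"
  shows "min_covering_size f \<le> enat n \<longleftrightarrow> (\<forall>x. \<exists>z. \<phi> z = - \<phi> x / (real n - 1))"
proof -
  have "(\<forall>x. \<exists>z. \<phi> z = - \<phi> x / (real n - 1)) \<longleftrightarrow>
      (\<forall>u\<in>range \<phi>. - u / (real n - 1) \<in> range \<phi>)"
    by (auto simp: image_iff) metis+
  also have "\<dots> \<longleftrightarrow> P_minus f = P_plus f \<or> P_minus f \<noteq> \<infinity> \<and> P_plus f \<noteq> \<infinity> \<and>
      real_of_ereal (max (P_plus f) (P_minus f)) / real_of_ereal (min (P_plus f) (P_minus f)) \<le> real n - 1"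
    unfolding Ball_def range_score
    using assms P_pos by (intro interval_scaled_reflection_iff) auto
  also have "\<dots> \<longleftrightarrow> min_covering_size f \<le> enat n"
  proof -
    have "nat \<lceil>r + 1\<rceil> \<le> n \<longleftrightarrow> r \<le> real n - 1" for r
      by (simp only: nat_ceiling_le_eq) linarith
    then show ?thesis
      using assms by (simp add: min_covering_size_def numeral_eq_enat del: ceiling_add_one)
  qed
  finally show ?thesis by simp
qed

section \<open>Sufficiency of the covering size\<close>

text \<open>The power \<open>d\<close> multiplies the score by a positive constant, which preserves
  both monotonicity and zero sums.\<close>

lemma powr_imp_same_location_mle:
  assumes g: "\<And>x. 0 < g x" "g C1_differentiable_on UNIV"
    and cd: "0 < c" "0 < d" "\<And>x. g x = c * f x powr d" and n: "1 \<le> n"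
  shows "same_location_mle n f g"
proof -
  have score: "location_score g x = d * \<phi> x" for x
    using location_score_powr[OF pos C1 cd(1,3)] .
  have "strict_mono (location_score g)"
    using mono cd(2) by (simp add: score strict_mono_def)
  then show ?thesis
  proof (rule same_location_mleI[OF pos C1 mono cross g _ n])
    fix y :: "nat \<Rightarrow> real"
    assume "(\<Sum>i=1..n. \<phi> (y i)) = 0"
    then show "(\<Sum>i=1..n. location_score g (y i)) = 0"
      unfolding score by (simp flip: sum_distrib_left)
  qed
qed

text \<open>The density \<open>f\<close> peaks at the zero \<open>z\<close> of its score. A
  nonpositive exponent would turn the peak into a minimum, so \<open>g\<close> would be bounded
  below by \<open>g z\<close>.\<close>

lemma powr_exponent_pos:
  assumes g: "full_support_density g" and c: "0 < c" "\<And>x. g x = c * f x powr k"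
  shows "0 < k"
proof (rule ccontr)
  assume "\<not> 0 < k"
  obtain z where z: "\<phi> z = 0" by (rule score_zero)
  have "f x \<le> f z" for x
    using concave_less_tangent[OF DERIV_ln_score[OF pos C1] mono, of x z] pos[of x] pos[of z]
    by (cases "x = z") (auto simp: z)
  then have "g z \<le> g x" for x
    unfolding c(2) using \<open>\<not> 0 < k\<close> c(1) pos by (intro mult_left_mono powr_mono2') auto
  then show False
    using full_support_density_not_bounded_below[OF g full_support_densityD(1)[OF g]] by blast
qed

lemma proportional_imp_powr:
  assumes g: "full_support_density g" "g C1_differentiable_on UNIV"
    and k: "\<And>x. location_score g x = k * \<phi> x"
  shows "\<exists>c d. 0 < c \<and> 0 < d \<and> (\<forall>x. g x = c * f x powr d)"
proof -
  obtain c where "0 < c" "\<And>x. g x = c * f x powr k"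
    using proportional_score_imp_powr[OF pos C1 full_support_densityD(1)[OF g(1)] g(2) k] by blast
  with powr_exponent_pos[OF g(1)] show ?thesis by blast
qed

text \<open>If the covering size is finite, a single \<open>n\<close> provides both the slope and
  the balancing samples. If it is infinite, the slope comes from size \<open>3\<close>, and each
  score is balanced at its own sample size.\<close>

lemma sufficient_sample_size_covering:
  "sufficient_sample_size f (max (min_covering_size f) 3)"
  unfolding sufficient_sample_size_def
proof (intro allI impI, elim conjE)
  let ?N = "max (min_covering_size f) 3"
  fix g assume g: "full_support_density g" "g C1_differentiable_on UNIV"
  note g_pos = full_support_densityD(1)[OF g(1)]
  let ?class = "\<exists>c d. 0 < c \<and> 0 < d \<and> (\<forall>x. g x = c * f x powr d)"
  have same: "same_location_mle n f g" if ?class "1 \<le> n" for n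
    using that powr_imp_same_location_mle[OF g_pos g(2)] by blast
  show "if ?N = \<infinity> then (\<forall>n\<ge>1. same_location_mle n f g) \<longleftrightarrow> ?class
    else \<forall>n\<ge>1. enat n \<ge> ?N \<longrightarrow> (same_location_mle n f g \<longleftrightarrow> ?class)"
  proof (cases "?N = \<infinity>")
    case True
    have ?class if all: "\<forall>n\<ge>1. same_location_mle n f g"
    proof -
      obtain k where k: "\<And>n x z. 2 \<le> n \<Longrightarrow> same_location_mle n f g \<Longrightarrow> \<phi> z = - \<phi> x / (real n - 1) \<Longrightarrow>
          location_score g x = k * \<phi> x"
        using same_location_mle_imp_proportional[OF g_pos g(2), of 3] all by auto
      have "location_score g x = k * \<phi> x" for x
      proof -
        obtain a b where ab: "\<phi> a < 0" "0 < \<phi> b"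
          using cross by (auto simp: crosses_zero_def)
        \<comment> \<open>All numbers in \<open>(- e, e)\<close> are scores, so
          \<open>- \<phi> x\<close> can be split into \<open>j\<close> equal scores once
          \<open>j\<close> exceeds \<open>\<bar>\<phi> x\<bar> / e\<close>. With \<open>x\<close>
          itself the sample has size \<open>Suc j\<close>.\<close>
        define e where "e = min (- \<phi> a) (\<phi> b)"
        have "0 < e" using ab by (simp add: e_def)
        obtain j :: nat where j: "\<bar>\<phi> x\<bar> / e < real j"
          using reals_Archimedean2 by blast
        have "1 \<le> j"
          using j \<open>0 < e\<close> by (cases j) (auto simp: divide_less_0_iff)
        have "\<bar>- \<phi> x / real j\<bar> < e"
          using j \<open>0 < e\<close> \<open>1 \<le> j\<close> by (simp add: field_simps)
        then have "\<phi> a \<le> - \<phi> x / real j" "- \<phi> x / real j \<le> \<phi> b"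
          unfolding abs_less_iff e_def by linarith+
        then have "- \<phi> x / real j \<in> range \<phi>"
          by (rule mem_is_interval_1_I[OF is_interval_range_score rangeI rangeI])
        then obtain z where "\<phi> z = - \<phi> x / (real (Suc j) - 1)" by auto
        then show ?thesis
          using k[of "Suc j" z x] all \<open>1 \<le> j\<close> by simp
      qed
      then show ?thesis by (rule proportional_imp_powr[OF g])
    qed
    then show ?thesis using True same by auto
  next
    case False
    have ?class if n: "1 \<le> n" "?N \<le> enat n" "same_location_mle n f g" for n
    proof -
      have "3 \<le> n"
        using n(2) by (simp add: numeral_eq_enat)
      obtain k where k: "\<And>n x z. 2 \<le> n \<Longrightarrow> same_location_mle n f g \<Longrightarrow> \<phi> z = - \<phi> x / (real n - 1) \<Longrightarrow>
          location_score g x = k * \<phi> x"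
        using same_location_mle_imp_proportional[OF g_pos g(2) \<open>3 \<le> n\<close> n(3)] by blast
      have "\<forall>x. \<exists>z. \<phi> z = - \<phi> x / (real n - 1)"
        using min_covering_size_le_iff[of n] n(2) \<open>3 \<le> n\<close> by simp
      then have "location_score g x = k * \<phi> x" for x
        using k[of n] n(3) \<open>3 \<le> n\<close> by fastforce
      then show ?thesis by (rule proportional_imp_powr[OF g])
    qed
    then show ?thesis
      unfolding if_not_P[OF False] using same by (intro allI impI iffI) simp_all
  qed
qed

section \<open>Counterexamples for small samples\<close>

lemma stretched_score_counterexample:
  assumes n: "1 \<le> n" and T: "0 < T" "T < \<bar>\<phi> a\<bar>"
    and zero_sum: "\<And>y. (\<Sum>i=1..n. \<phi> (y i)) = 0 \<Longrightarrow> (\<Sum>i=1..n. stretch T (\<phi> (y i))) = 0"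
  obtains g where "full_support_density g" "g C1_differentiable_on UNIV" "same_location_mle n f g"
    "\<not> (\<exists>c d. 0 < c \<and> 0 < d \<and> (\<forall>x. g x = c * f x powr d))"
proof -
  let ?s = "\<lambda>x. stretch T (\<phi> x)"
  have less: "?s x < ?s y" if "x < y" for x y
    using that mono strict_mono_stretch[OF T(1)] by (simp add: strict_mono_less)
  have "crosses_zero ?s"
  proof -
    obtain a b where "\<phi> a < 0" "0 < \<phi> b"
      using cross by (auto simp: crosses_zero_def)
    then have "stretch T (\<phi> a) < stretch T 0" "stretch T 0 < stretch T (\<phi> b)"
      by (simp_all only: strict_mono_less[OF strict_mono_stretch[OF T(1)]])
    then show ?thesis
      by (auto simp: crosses_zero_def)
  qed
  then obtain g where g: "full_support_density g" "g C1_differentiable_on UNIV" "location_score g = ?s"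
    using exists_density_with_score[of ?s] isCont_o2[OF isCont_score isCont_stretch[OF T(1)]] less
    by (auto simp: strict_mono_def)
  note g_pos = full_support_densityD(1)[OF g(1)]
  have "same_location_mle n f g"
    using same_location_mleI[OF pos C1 mono cross g_pos g(2) _ n] zero_sum less
    by (simp add: g(3) strict_mono_def)
  moreover have False if "0 < c" "\<And>x. g x = c * f x powr d" for c d
  proof -
    have d: "stretch T (\<phi> x) = d * \<phi> x" for x
      using location_score_powr[OF pos C1 that, of x] by (simp add: g(3))
    \<comment> \<open>At this point the score has absolute value \<open>T\<close>, where
      \<open>stretch\<close> is still the identity, so \<open>d = 1\<close>; at \<open>a\<close> the
      factor is \<open>\<bar>\<phi> a\<bar> / T\<close>, which exceeds \<open>1\<close>.\<close>
    obtain z where z: "\<phi> z = T / \<bar>\<phi> a\<bar> * \<phi> a"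
      using score_scaled[of "T / \<bar>\<phi> a\<bar>" a] T by auto
    have "\<bar>\<phi> z\<bar> = T"
      using T unfolding z by (simp add: abs_mult)
    then have "d = 1"
      using d[of z] T by (auto simp: stretch_eq_self)
    then show False
      using d[of a] T by (auto simp: stretch_def max_def field_simps split: if_splits)
  qed
  ultimately show thesis using that g by blast
qed

text \<open>Two scores with zero sum are opposite, and \<open>stretch\<close> is odd. The threshold
  is half of a positive score \<open>\<phi> b\<close>, so that \<open>\<phi> b\<close> itself is
  moved.\<close>

lemma sample_size_two_insufficient:
  obtains g where "full_support_density g" "g C1_differentiable_on UNIV" "same_location_mle 2 f g"
    "\<not> (\<exists>c d. 0 < c \<and> 0 < d \<and> (\<forall>x. g x = c * f x powr d))"
proof -
  obtain b where "0 < \<phi> b"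
    using cross by (auto simp: crosses_zero_def)
  show thesis
  proof (rule stretched_score_counterexample[of 2 "\<phi> b / 2" b, OF _ _ _ _ that])
    fix y :: "nat \<Rightarrow> real"
    assume "(\<Sum>i=1..2. \<phi> (y i)) = 0"
    then have "\<phi> (y 2) = - \<phi> (y 1)"
      by (simp add: numeral_2_eq_2)
    then show "(\<Sum>i=1..2. stretch (\<phi> b / 2) (\<phi> (y i))) = 0"
      by (simp add: numeral_2_eq_2)
  qed (use \<open>0 < \<phi> b\<close> in auto)
qed

text \<open>
  If \<open>- \<phi> x / (n - 1)\<close> is not a score, then \<open>n - 1\<close> scores cannot compensate for one beyond \<open>\<phi> x\<close>,
  so the stretching is invisible to samples of size \<open>n\<close>.
\<close>

lemma uncovered_sample_size_insufficient:
  assumes n: "2 \<le> n" "enat n < min_covering_size f"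
  obtains g where "full_support_density g" "g C1_differentiable_on UNIV" "same_location_mle n f g"
    "\<not> (\<exists>c d. 0 < c \<and> 0 < d \<and> (\<forall>x. g x = c * f x powr d))"
proof -
  obtain x where "\<not> (\<exists>z. \<phi> z = - \<phi> x / (real n - 1))"
    using min_covering_size_le_iff[OF n(1)] n(2) by auto
  then have x: "- \<phi> x / (real n - 1) \<notin> range \<phi>"
    by (metis rangeE)
  have "\<phi> x \<noteq> 0"
    using x zero_in_range_score by auto
  \<comment> \<open>Multiplying by the sign of \<open>\<phi> x\<close> treats both ends of the range
    in one computation.\<close>
  define \<sigma> where "\<sigma> = sgn (\<phi> x)"
  have \<sigma>: "\<sigma> = 1 \<or> \<sigma> = -1" "\<sigma> * \<phi> x = \<bar>\<phi> x\<bar>"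
    using \<open>\<phi> x \<noteq> 0\<close> by (auto simp: \<sigma>_def sgn_if)
  \<comment> \<open>A score at or beyond this bound would, together with the score \<open>0\<close>,
    enclose \<open>- \<phi> x / (real n - 1)\<close>.\<close>
  have lower: "- \<bar>\<phi> x\<bar> / (real n - 1) < \<sigma> * \<phi> y" for y
  proof (rule ccontr)
    assume "\<not> ?thesis"
    then have y: "\<sigma> * \<phi> y \<le> - \<bar>\<phi> x\<bar> / (real n - 1)" by simp
    have le: "- \<bar>\<phi> x\<bar> / (real n - 1) \<le> 0"
      using n(1) by simp
    have "- \<phi> x / (real n - 1) \<in> range \<phi>"
    proof (cases "\<sigma> = 1")
      case True
      then have "\<bar>\<phi> x\<bar> = \<phi> x" using \<sigma>(2) by simp
      then have "\<phi> y \<le> - \<phi> x / (real n - 1)" "- \<phi> x / (real n - 1) \<le> 0"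
        using y le True by simp_all
      then show ?thesis
        by (rule mem_is_interval_1_I[OF is_interval_range_score rangeI zero_in_range_score])
    next
      case False
      then have "\<sigma> = -1" using \<sigma>(1) by simp
      then have "\<bar>\<phi> x\<bar> = - \<phi> x" using \<sigma>(2)[symmetric] by (simp only: mult_minus1)
      then have "0 \<le> - \<phi> x / (real n - 1)" "- \<phi> x / (real n - 1) \<le> \<phi> y"
        using y le \<open>\<sigma> = -1\<close> by simp_all
      then show ?thesis
        by (rule mem_is_interval_1_I[OF is_interval_range_score zero_in_range_score rangeI])
    qed
    with x show False by contradiction
  qed
  \<comment> \<open>One unit further out lies a score that the stretching with threshold
    \<open>\<bar>\<phi> x\<bar>\<close> does move.\<close>
  have "\<bar>\<phi> x\<bar> < \<bar>\<phi> (x + \<sigma>)\<bar>"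
  proof -
    have "\<phi> x < \<phi> (x + 1)" "\<phi> (x - 1) < \<phi> x"
      using mono by (simp_all add: strict_mono_less)
    then show ?thesis using \<open>\<phi> x \<noteq> 0\<close> by (auto simp: \<sigma>_def sgn_if)
  qed
  then show thesis
  proof (rule stretched_score_counterexample[of n "\<bar>\<phi> x\<bar>", OF _ _ _ _ that, rotated 2])
    fix y :: "nat \<Rightarrow> real"
    assume y: "(\<Sum>i=1..n. \<phi> (y i)) = 0"
    have "\<bar>\<phi> (y i)\<bar> \<le> \<bar>\<phi> x\<bar>" if i: "i \<in> {1..n}" for i
    proof -
      have "(\<Sum>j\<in>{1..n} - {i}. - \<bar>\<phi> x\<bar> / (real n - 1)) \<le> (\<Sum>j\<in>{1..n} - {i}. \<sigma> * \<phi> (y j))"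
        using lower by (intro sum_mono less_imp_le)
      also have "(\<Sum>j\<in>{1..n} - {i}. - \<bar>\<phi> x\<bar> / (real n - 1)) = - \<bar>\<phi> x\<bar>"
        using i n(1) by (simp add: of_nat_diff)
      also have "(\<Sum>j\<in>{1..n} - {i}. \<sigma> * \<phi> (y j)) = - \<sigma> * \<phi> (y i)"
        using y i by (simp add: sum_diff1 flip: sum_distrib_left)
      finally have "\<sigma> * \<phi> (y i) \<le> \<bar>\<phi> x\<bar>" by simp
      \<comment> \<open>On the opposite side \<open>lower\<close> is already the stronger bound,
        since \<open>1 \<le> n - 1\<close>.\<close>
      moreover have "- \<bar>\<phi> x\<bar> \<le> \<sigma> * \<phi> (y i)"
      proof -
        have "\<bar>\<phi> x\<bar> / (real n - 1) \<le> \<bar>\<phi> x\<bar>"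
          using n(1) by (simp add: divide_le_eq mult_le_cancel_left1)
        then show ?thesis using lower[of "y i"] by simp
      qed
      ultimately show ?thesis using \<sigma>(1) by auto
    qed
    then have "(\<Sum>i=1..n. stretch \<bar>\<phi> x\<bar> (\<phi> (y i))) = (\<Sum>i=1..n. \<phi> (y i))"
      using \<open>\<phi> x \<noteq> 0\<close> by (intro sum.cong) (auto intro!: stretch_eq_self)
    with y show "(\<Sum>i=1..n. stretch \<bar>\<phi> x\<bar> (\<phi> (y i))) = 0" by simp
  qed (use n(1) \<open>\<phi> x \<noteq> 0\<close> in auto)
qed

text \<open>A finite \<open>N = j\<close> below the bound fails at size \<open>2\<close> if
  \<open>j \<le> 2\<close>, and otherwise at size \<open>j\<close> itself, which is then below the
  covering size.\<close>

lemma sufficient_sample_size_ge: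
  assumes "sufficient_sample_size f N"
  shows "max (min_covering_size f) 3 \<le> N"
proof (rule ccontr)
  assume "\<not> ?thesis"
  then have less: "N < max (min_covering_size f) 3" by (simp only: not_le)
  then obtain j where j: "N = enat j"
    by (cases N) auto
  have suff: "\<exists>c d. 0 < c \<and> 0 < d \<and> (\<forall>x. g x = c * f x powr d)"
    if "full_support_density g" "g C1_differentiable_on UNIV" "1 \<le> n" "j \<le> n" "same_location_mle n f g"
    for g n
    using assms that unfolding sufficient_sample_size_def j by auto
  show False
  proof (cases "j \<le> 2")
    case True
    obtain g where g: "full_support_density g" "g C1_differentiable_on UNIV" "same_location_mle 2 f g"
      and no: "\<not> (\<exists>c d. 0 < c \<and> 0 < d \<and> (\<forall>x. g x = c * f x powr d))"
      by (rule sample_size_two_insufficient)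
    show False using suff[OF g(1,2) one_le_numeral True g(3)] no by contradiction
  next
    case False
    then have "2 \<le> j" "enat j < min_covering_size f"
      using less by (auto simp: j numeral_eq_enat less_max_iff_disj)
    then obtain g where g: "full_support_density g" "g C1_differentiable_on UNIV" "same_location_mle j f g"
      and no: "\<not> (\<exists>c d. 0 < c \<and> 0 < d \<and> (\<forall>x. g x = c * f x powr d))"
      by (rule uncovered_sample_size_insufficient)
    have "1 \<le> j" using \<open>2 \<le> j\<close> by simp
    then show False using suff[OF g(1,2) _ order_refl g(3)] no by blast
  qed
qed

end

section \<open>Location classes\<close>

lemma location_class_subset:
  assumes f: "\<And>x. 0 < f x" and cd: "0 < c" "0 < d" "\<And>x. g x = c * f x powr d"
  shows "location_class g \<subseteq> location_class f"
proof
  fix h assume "h \<in> location_class g"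
  then obtain c' d' where h: "full_support_density h" "0 < d'" "\<And>x. h x = c' * g x powr d'"
    by (auto simp: location_class_def)
  have "h x = (c' * c powr d') * f x powr (d * d')" for x
    using f[of x] cd by (simp add: h(3) powr_mult powr_powr)
  then show "h \<in> location_class f"
    using h(1) mult_pos_pos[OF cd(2) h(2)] unfolding location_class_def by blast
qed

lemma location_class_eq_iff:
  assumes f: "full_support_density f" and g: "full_support_density g"
  shows "(\<exists>c d. 0 < c \<and> 0 < d \<and> (\<forall>x. g x = c * f x powr d)) \<longleftrightarrow> location_class f = location_class g"
proof
  note pos = full_support_densityD(1)[OF f] full_support_densityD(1)[OF g]
  assume "\<exists>c d. 0 < c \<and> 0 < d \<and> (\<forall>x. g x = c * f x powr d)"
  then obtain c d where cd: "0 < c" "0 < d" "\<And>x. g x = c * f x powr d" by blast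
  \<comment> \<open>Solving \<open>g = c * f powr d\<close> for \<open>f\<close> makes the relation
    symmetric.\<close>
  have "f x = c powr (- 1 / d) * g x powr (1 / d)" for x
    using pos(1)[of x] cd by (simp add: powr_mult powr_powr flip: powr_add mult.assoc)
  then have "location_class f \<subseteq> location_class g"
    using cd by (intro location_class_subset[OF pos(2), of "c powr (- 1 / d)" "1 / d"]) auto
  moreover have "location_class g \<subseteq> location_class f"
    by (rule location_class_subset[OF pos(1) cd])
  ultimately show "location_class f = location_class g" by blast
next
  assume eq: "location_class f = location_class g"
  have "g x = 1 * g x powr 1" for x
    using full_support_densityD(1)[OF g, of x] by simp
  then have "g \<in> location_class g"
    unfolding location_class_def using g zero_less_one by blast
  then have "g \<in> location_class f"
    by (simp only: eq)
  then obtain c d where cd: "0 < d" "\<And>x. g x = c * f x powr d"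
    by (auto simp: location_class_def)
  \<comment> \<open>\<open>location_class\<close> does not state the sign of the constant; the
    positive values of both densities at \<open>0\<close> give it.\<close>
  moreover have "0 < c"
    using full_support_densityD(1)[OF g, of 0] full_support_densityD(1)[OF f, of 0]
    by (simp add: cd(2) zero_less_mult_iff)
  ultimately show "\<exists>c d. 0 < c \<and> 0 < d \<and> (\<forall>x. g x = c * f x powr d)" by blast
qed

theorem theorem4p1:
  fixes f :: "real \<Rightarrow> real"
  assumes "full_support_density f"
    and "f C1_differentiable_on UNIV"
    and "inj (location_score f)"
    and "crosses_zero (location_score f)"
  shows "(\<exists>N. sufficient_sample_size f N) \<and>
         MNSS f = max (min_covering_size f) 3 \<and>
         (\<forall>g. full_support_density g \<and> g C1_differentiable_on UNIV \<longrightarrow>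
           ((\<exists>c d. 0 < c \<and> 0 < d \<and> (\<forall>x. g x = c * f x powr d)) \<longleftrightarrow>
            location_class f = location_class g))"
proof -
  interpret increasing_score f
    using assms strict_mono_location_score by unfold_locales
  show ?thesis
    unfolding MNSS_def
    using sufficient_sample_size_covering sufficient_sample_size_ge location_class_eq_iff[OF assms(1)]
    by (auto intro!: Least_equality)
qed

end
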